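(* For every $\ell\ge0$ and arbitrary nonzero $p,q$, as polynomial identities in $s$: (i) $s^2g_\ell'+(\sigma-2\ell s)\,g_\ell=\widetilde C_\ell$; (ii) $\widetilde C_{\ell+1}=\widetilde D_\ell+\rho\,(2\ell+1)\,s\,g_\ell$ and $\widetilde D_{\ell+1}=\widetilde C_\ell+2(2\ell+1)\,s\,g_\ell$; (iii) $\widetilde C_{\ell+2}=\widetilde C_\ell+2(2\ell+1)\,s\,g_\ell+\rho\,(2\ell+3)\,s\,g_{\ell+1}$.
   Context: Bessel polynomials: $y_n(x)=\sum_{k=0}^n\frac{(n+k)!}{(n-k)!\,k!\,2^k}x^k$ for $n\ge0$, with the convention $y_{-1}=1$. For fixed nonzero $p,q$ and $\ell\ge0$ set $$g_\ell(s)=y_\ell(ps)\,y_\ell(qs),\qquad \widetilde C_\ell(s)=\frac{y_{\ell-1}(ps)\,y_\ell(qs)}{p}+\frac{y_\ell(ps)\,y_{\ell-1}(qs)}{q},$$ $$\widetilde D_\ell(s)=\frac{y_\ell(ps)\,y_{\ell-1}(qs)}{p}+\frac{y_{\ell-1}(ps)\,y_\ell(qs)}{q},\qquad \sigma=\frac1p+\frac1q,\qquad \rho=\frac pq+\frac qp .$$ The prime denotes $d/ds$. *)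

theory Defs
  imports "HOL-Computational_Algebra.Polynomial"
begin

text \<open>The index is an integer so that the convention \<open>y\<^sub>-\<^sub>1 = 1\<close> can be expressed; the
  value at indices below \<open>-1\<close> is never used. In the sum, \<open>k \<le> n\<close>, so the natural-number
  subtraction does not truncate.\<close>

definition bessel_y :: "int \<Rightarrow> 'a::field_char_0 poly" where
  "bessel_y m = (if m < 0 then 1 else
     (let n = nat m in
       \<Sum>k\<le>n. monom (fact (n + k) / (fact (n - k) * fact k * 2 ^ k)) k))"

text \<open>The polynomial \<open>y\<^sub>m(c s)\<close> in the indeterminate \<open>s\<close>.\<close>

definition bessel_y_scaled :: "int \<Rightarrow> 'a::field_char_0 \<Rightarrow> 'a poly" where
  "bessel_y_scaled m c = pcompose (bessel_y m) (monom c 1)"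

definition g_poly :: "'a::field_char_0 \<Rightarrow> 'a \<Rightarrow> nat \<Rightarrow> 'a poly" where
  "g_poly p q l = bessel_y_scaled (int l) p * bessel_y_scaled (int l) q"

definition C_poly :: "'a::field_char_0 \<Rightarrow> 'a \<Rightarrow> nat \<Rightarrow> 'a poly" where
  "C_poly p q l =
     smult (1 / p) (bessel_y_scaled (int l - 1) p * bessel_y_scaled (int l) q)
   + smult (1 / q) (bessel_y_scaled (int l) p * bessel_y_scaled (int l - 1) q)"

definition D_poly :: "'a::field_char_0 \<Rightarrow> 'a \<Rightarrow> nat \<Rightarrow> 'a poly" where
  "D_poly p q l =
     smult (1 / p) (bessel_y_scaled (int l) p * bessel_y_scaled (int l - 1) q)
   + smult (1 / q) (bessel_y_scaled (int l - 1) p * bessel_y_scaled (int l) q)"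

definition sigma :: "'a::field_char_0 \<Rightarrow> 'a \<Rightarrow> 'a" where
  "sigma p q = 1 / p + 1 / q"

definition rho :: "'a::field_char_0 \<Rightarrow> 'a \<Rightarrow> 'a" where
  "rho p q = p / q + q / p"

text \<open>The indeterminate \<open>s\<close>.\<close>

abbreviation svar :: "'a::field_char_0 poly" where
  "svar \<equiv> monom 1 1"

end

theory Submission
  imports Defs
begin

text \<open>All identities come from two classical relations of contiguity for the Bessel polynomials,
  valid for \<open>n \<ge> 0\<close> because of the convention \<open>y\<^sub>-\<^sub>1 = 1\<close>:
  \<open>y\<^sub>n\<^sub>+\<^sub>1 = (2n+1) x y\<^sub>n + y\<^sub>n\<^sub>-\<^sub>1\<close> and \<open>x\<^sup>2 y\<^sub>n' = (n x - 1) y\<^sub>n + y\<^sub>n\<^sub>-\<^sub>1\<close>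
  (lemmas \<open>bessel_y_recurrence\<close> and \<open>bessel_y_derivative\<close>). Each is a comparison of coefficients,
  that is, a relation between quotients of factorials.

  Substituting \<open>x = p s\<close> and \<open>x = q s\<close> turns the second relation into a first-order equation
  for each factor of \<open>g\<^sub>l\<close>. By the product rule, the multiples of \<open>y\<^sub>l(ps) y\<^sub>l(qs)\<close> add up to
  \<open>2 l s - \<sigma>\<close>, and the two remaining terms are those of the polynomial \<open>C\<^sub>l\<close>; this is (i).
  In \<open>C\<^sub>l\<^sub>+\<^sub>1\<close> and \<open>D\<^sub>l\<^sub>+\<^sub>1\<close> each summand contains exactly one factor of index \<open>l + 1\<close>. The recurrence
  splits it into a multiple of \<open>s g\<^sub>l\<close>, weighted by \<open>q/p\<close> and \<open>p/q\<close> in \<open>C\<close>, by \<open>1\<close> and \<open>1\<close> in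
  \<open>D\<close>, and a term with an index lowered by two, where the roles of \<open>C\<close> and \<open>D\<close> are exchanged;
  this is (ii). Two steps of (ii) give (iii).\<close>

section \<open>Coefficients of the Bessel polynomials\<close>

text \<open>Cutting off at \<open>k = n\<close> is essential: beyond it the truncated subtraction would make
  the quotient nonzero.\<close>

definition bessel_coeff :: "nat \<Rightarrow> nat \<Rightarrow> 'a::field_char_0" where
  "bessel_coeff n k =
     (if k \<le> n then fact (n + k) / (fact (n - k) * fact k * 2 ^ k) else 0)"

lemma coeff_bessel_y: "coeff (bessel_y (int n)) k = bessel_coeff n k"
proof -
  have "coeff (bessel_y (int n) :: 'a poly) k =
          (\<Sum>i\<le>n. if i = k then fact (n + i) / (fact (n - i) * fact i * 2 ^ i) else 0)"
    by (simp add: bessel_y_def coeff_sum)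
  also have "\<dots> = bessel_coeff n k"
    by (simp add: bessel_coeff_def)
  finally show ?thesis .
qed

lemma bessel_y_minus_one: "bessel_y (- 1) = 1"
  by (simp add: bessel_y_def)

lemma bessel_y_0: "bessel_y 0 = 1"
  by (simp add: bessel_y_def)

lemma bessel_coeff_0: "bessel_coeff n 0 = 1"
  by (simp add: bessel_coeff_def)

lemma bessel_coeff_add:
  "bessel_coeff (k + j) k = fact (2 * k + j) / (fact j * fact k * 2 ^ k)"
  by (simp add: bessel_coeff_def mult_2 add_ac)

lemma bessel_coeff_eq_0: "n < k \<Longrightarrow> bessel_coeff n k = 0"
  by (simp add: bessel_coeff_def)

text \<open>This is the coefficient of \<open>x\<^sup>k\<^sup>+\<^sup>1\<close> in \<open>x\<^sup>2 y\<^sub>m' = (m x - 1) y\<^sub>m + y\<^sub>m\<^sub>-\<^sub>1\<close> for \<open>m = n + 1\<close>.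
  In the range \<open>k < n\<close>, where \<open>n = k + 1 + j\<close>, each coefficient involved is
  \<open>F = (2k + j + 2)! / (j! k! 2\<^sup>k)\<close> times a rational function of \<open>j\<close> and \<open>k\<close>, and the claim is an
  identity between these functions. The cases near the end of the coefficient range are separate
  because there some coefficients vanish.\<close>

lemma bessel_coeff_derivative:
  "of_nat k * bessel_coeff (Suc n) k =
     of_nat (Suc n) * bessel_coeff (Suc n) k - bessel_coeff (Suc n) (Suc k)
       + (bessel_coeff n (Suc k) :: 'a::field_char_0)"
proof -
  consider j where "n = Suc k + j" | "k = n" | "k = Suc n" | "Suc n < k"
    by (metis Suc_leI less_iff_Suc_add add_Suc linorder_neqE_nat Suc_lessI)
  then show ?thesis
  proof cases
    case 1
    have e: "Suc n = k + Suc (Suc j)" "Suc n = Suc k + Suc j" "n = Suc k + j"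
      using 1 by auto
    have a: "bessel_coeff (Suc n) k = (fact (2*k + Suc (Suc j)) / (fact (Suc (Suc j)) * fact k * 2 ^ k) :: 'a)"
      by (simp only: e(1) bessel_coeff_add)
    have b: "bessel_coeff (Suc n) (Suc k) = (fact (2*Suc k + Suc j) / (fact (Suc j) * fact (Suc k) * 2 ^ Suc k) :: 'a)"
      by (simp only: e(2) bessel_coeff_add)
    have c: "bessel_coeff n (Suc k) = (fact (2*Suc k + j) / (fact j * fact (Suc k) * 2 ^ Suc k) :: 'a)"
      by (simp only: e(3) bessel_coeff_add)
    define F where "F = (fact (2*k+j+2) / (fact j * fact k * 2^k) :: 'a)"
    have nz: "(of_nat (Suc j) :: 'a) \<noteq> 0" "(of_nat (Suc (Suc j)) :: 'a) \<noteq> 0" "(of_nat (Suc k) :: 'a) \<noteq> 0"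
      by (rule of_nat_neq_0)+
    \<comment> \<open>The same denominators in the shape that simplification gives them when the fractions are cleared.\<close>
    have nz': "(2 + of_nat k * 2 :: 'a) \<noteq> 0" "(4 + of_nat k * 4 :: 'a) \<noteq> 0"
      using of_nat_neq_0[of "2 * k + 1", where ?'a = 'a] of_nat_neq_0[of "4 * k + 3", where ?'a = 'a]
      by (simp_all add: algebra_simps)
    have a': "bessel_coeff (Suc n) k = F / (of_nat (Suc j) * of_nat (Suc (Suc j)))"
      unfolding a F_def by (simp add: mult_ac)
    have b': "bessel_coeff (Suc n) (Suc k) = F * of_nat (2*k+j+3) / (of_nat (Suc j) * of_nat (Suc k) * 2)"
      unfolding b F_def by (simp add: mult_ac numeral_3_eq_3)
    have c': "bessel_coeff n (Suc k) = F / (of_nat (Suc k) * 2)"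
      unfolding c F_def by (simp add: mult_ac)
    show ?thesis unfolding a' b' c' unfolding 1 using nz nz'
      by (simp add: divide_simps) (simp add: algebra_simps)
  next
    case 2
    have a: "bessel_coeff (Suc n) n = (fact (2*n + 1) / (fact 1 * fact n * 2 ^ n) :: 'a)"
      using bessel_coeff_add[of n 1] by simp
    have b: "bessel_coeff (Suc n) (Suc n) = (fact (2*Suc n) / (fact (Suc n) * 2 ^ Suc n) :: 'a)"
      using bessel_coeff_add[of "Suc n" 0] by simp
    have nz: "(1 + of_nat n :: 'a) \<noteq> 0" "(2 + of_nat n * 2 :: 'a) \<noteq> 0"
      using of_nat_neq_0[of n, where ?'a = 'a] of_nat_neq_0[of "2 * n + 1", where ?'a = 'a]
      by (simp_all add: algebra_simps)
    show ?thesis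
      unfolding 2 a b using nz
      by (simp add: bessel_coeff_eq_0 divide_simps) (simp add: algebra_simps)
  qed (simp_all add: bessel_coeff_eq_0)
qed

text \<open>The coefficient of \<open>x\<^sup>k\<^sup>+\<^sup>1\<close> in \<open>y\<^sub>m\<^sub>+\<^sub>1 = (2m+1) x y\<^sub>m + y\<^sub>m\<^sub>-\<^sub>1\<close> for \<open>m = n + 1\<close>, by the same
  reduction to rational functions. The case \<open>k = n + 1\<close> is not trivial here, since it compares
  leading coefficients.\<close>

lemma bessel_coeff_recurrence:
  "bessel_coeff (Suc (Suc n)) (Suc k) =
     of_nat (2 * n + 3) * bessel_coeff (Suc n) k + (bessel_coeff n (Suc k) :: 'a::field_char_0)"
proof -
  consider j where "n = Suc k + j" | "k = n" | "k = Suc n" | "Suc n < k"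
    by (metis Suc_leI less_iff_Suc_add add_Suc linorder_neqE_nat Suc_lessI)
  then show ?thesis
  proof cases
    case 1
    have e: "Suc (Suc n) = Suc k + Suc (Suc j)" "Suc n = k + Suc (Suc j)" "n = Suc k + j"
      using 1 by auto
    have a: "bessel_coeff (Suc n) k = (fact (2*k + Suc (Suc j)) / (fact (Suc (Suc j)) * fact k * 2 ^ k) :: 'a)"
      by (simp only: e(2) bessel_coeff_add)
    have b: "bessel_coeff (Suc (Suc n)) (Suc k) = (fact (2*Suc k + Suc (Suc j)) / (fact (Suc (Suc j)) * fact (Suc k) * 2 ^ Suc k) :: 'a)"
      by (simp only: e(1) bessel_coeff_add)
    have c: "bessel_coeff n (Suc k) = (fact (2*Suc k + j) / (fact j * fact (Suc k) * 2 ^ Suc k) :: 'a)"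
      by (simp only: e(3) bessel_coeff_add)
    define F where "F = (fact (2*k+j+2) / (fact j * fact k * 2^k) :: 'a)"
    have nz: "(of_nat (Suc j) :: 'a) \<noteq> 0" "(of_nat (Suc (Suc j)) :: 'a) \<noteq> 0" "(of_nat (Suc k) :: 'a) \<noteq> 0"
      by (rule of_nat_neq_0)+
    \<comment> \<open>The same denominators in the shape that simplification gives them when the fractions are cleared.\<close>
    have nz': "(2 + of_nat k * 2 :: 'a) \<noteq> 0" "(4 + of_nat k * 4 :: 'a) \<noteq> 0"
      using of_nat_neq_0[of "2 * k + 1", where ?'a = 'a] of_nat_neq_0[of "4 * k + 3", where ?'a = 'a]
      by (simp_all add: algebra_simps)
    have a': "bessel_coeff (Suc n) k = F / (of_nat (Suc j) * of_nat (Suc (Suc j)))"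
      unfolding a F_def by (simp add: mult_ac)
    have b': "bessel_coeff (Suc (Suc n)) (Suc k) = F * of_nat (2*k+j+3) * of_nat (2*k+j+4)
        / (of_nat (Suc j) * of_nat (Suc (Suc j)) * of_nat (Suc k) * 2)"
      unfolding b F_def by (simp add: mult_ac eval_nat_numeral)
    have c': "bessel_coeff n (Suc k) = F / (of_nat (Suc k) * 2)"
      unfolding c F_def by (simp add: mult_ac)
    show ?thesis unfolding a' b' c' unfolding 1 using nz nz'
      by (simp add: divide_simps) (simp add: algebra_simps)
  next
    case 2
    have a: "bessel_coeff (Suc n) n = (fact (2*n + 1) / (fact 1 * fact n * 2 ^ n) :: 'a)"
      using bessel_coeff_add[of n 1] by simp
    have b: "bessel_coeff (Suc (Suc n)) (Suc n) = (fact (2*Suc n + 1) / (fact 1 * fact (Suc n) * 2 ^ Suc n) :: 'a)"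
      using bessel_coeff_add[of "Suc n" 1] by simp
    have nz: "(1 + of_nat n :: 'a) \<noteq> 0" "(2 + of_nat n * 2 :: 'a) \<noteq> 0"
      using of_nat_neq_0[of n, where ?'a = 'a] of_nat_neq_0[of "2 * n + 1", where ?'a = 'a]
      by (simp_all add: algebra_simps)
    show ?thesis
      unfolding 2 a b using nz
      by (simp add: bessel_coeff_eq_0 divide_simps) (simp add: algebra_simps)
  next
    case 3
    have a: "bessel_coeff (Suc n) (Suc n) = (fact (2*Suc n) / (fact (Suc n) * 2 ^ Suc n) :: 'a)"
      using bessel_coeff_add[of "Suc n" 0] by simp
    have b: "bessel_coeff (Suc (Suc n)) (Suc (Suc n)) = (fact (2*Suc (Suc n)) / (fact (Suc (Suc n)) * 2 ^ Suc (Suc n)) :: 'a)"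
      using bessel_coeff_add[of "Suc (Suc n)" 0] by simp
    have nz: "(1 + of_nat n :: 'a) \<noteq> 0" "(2 + of_nat n * 2 :: 'a) \<noteq> 0"
      using of_nat_neq_0[of n, where ?'a = 'a] of_nat_neq_0[of "2 * n + 1", where ?'a = 'a]
      by (simp_all add: algebra_simps)
    have nz': "(2 + of_nat n :: 'a) \<noteq> 0" "(8 + of_nat n * 4 :: 'a) \<noteq> 0"
      using of_nat_neq_0[of "Suc n", where ?'a = 'a] of_nat_neq_0[of "4 * n + 7", where ?'a = 'a]
      by (simp_all add: algebra_simps)
    show ?thesis
      unfolding 3 a b using nz nz'
      by (simp add: bessel_coeff_eq_0 divide_simps) (simp add: algebra_simps)
  qed (simp_all add: bessel_coeff_eq_0)
qed

section \<open>Contiguity relations\<close>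

lemma svar_mult: "svar * f = pCons 0 f"
  by (simp add: monom_altdef)

lemma bessel_y_recurrence:
  "(bessel_y (int n + 1) :: 'a::field_char_0 poly) =
     of_nat (2 * n + 1) * svar * bessel_y (int n) + bessel_y (int n - 1)"
proof (cases n)
  case 0
  have "(bessel_y 1 :: 'a poly) = svar + 1"
    by (simp add: bessel_y_def monom_0 one_pCons)
  then show ?thesis
    using 0 by (simp add: bessel_y_0 bessel_y_minus_one)
next
  case (Suc m)
  have "bessel_y (int (Suc (Suc m))) =
          smult (of_nat (2 * m + 3)) (pCons 0 (bessel_y (int (Suc m)))) + (bessel_y (int m) :: 'a poly)"
  proof (rule poly_eqI)
    fix k
    show "coeff (bessel_y (int (Suc (Suc m)))) k =
        coeff (smult (of_nat (2 * m + 3)) (pCons 0 (bessel_y (int (Suc m)))) + (bessel_y (int m) :: 'a poly)) k"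
      by (cases k) (simp_all only: coeff_bessel_y coeff_add coeff_smult coeff_pCons_0
          coeff_pCons_Suc bessel_coeff_0 bessel_coeff_recurrence, simp)
  qed
  also have "\<dots> = of_nat (2 * n + 1) * svar * bessel_y (int n) + bessel_y (int n - 1)"
  proof -
    have "smult (of_nat (2 * m + 3)) f = of_nat (2 * n + 1) * f" for f :: "'a poly"
      using Suc by (simp only: of_nat_poly) (simp add: numeral_3_eq_3)
    then show ?thesis
      using Suc by (simp only: mult.assoc svar_mult) simp
  qed
  finally show ?thesis using Suc by (simp add: add.commute)
qed

lemma bessel_y_derivative:
  "svar ^ 2 * pderiv (bessel_y (int n)) =
     (of_nat n * svar - 1) * bessel_y (int n) + (bessel_y (int n - 1) :: 'a::field_char_0 poly)"
proof (cases n)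
  case 0
  then show ?thesis by (simp add: bessel_y_0 bessel_y_minus_one)
next
  case (Suc m)
  have "pCons 0 (pCons 0 (pderiv (bessel_y (int (Suc m))))) =
          smult (of_nat (Suc m)) (pCons 0 (bessel_y (int (Suc m))))
            - bessel_y (int (Suc m)) + (bessel_y (int m) :: 'a poly)" (is "?L = ?R")
  proof (rule poly_eqI)
    fix k
    show "coeff ?L k = coeff ?R k"
    proof (cases k)
      case 0
      then show ?thesis
        by (simp only: coeff_bessel_y coeff_add coeff_diff coeff_smult coeff_pCons_0 bessel_coeff_0) simp
    next
      case (Suc k')
      have "coeff ?L k = of_nat k' * bessel_coeff (Suc m) k'"
        unfolding Suc by (cases k') (simp_all only: coeff_pCons_Suc coeff_pCons_0 coeff_pderiv coeff_bessel_y, simp)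
      also have "\<dots> = coeff ?R k"
        unfolding Suc by (simp only: coeff_bessel_y coeff_add coeff_diff coeff_smult
            coeff_pCons_Suc bessel_coeff_derivative)
      finally show ?thesis .
    qed
  qed
  moreover have "smult (of_nat (Suc m)) f = of_nat n * f" for f :: "'a poly"
    using Suc by (simp only: of_nat_poly) simp
  moreover have "svar ^ 2 * f = pCons 0 (pCons 0 f)" for f :: "'a poly"
    unfolding power2_eq_square mult.assoc by (simp only: svar_mult)
  ultimately show ?thesis
    using Suc by (simp only: left_diff_distrib mult.assoc svar_mult) simp
qed

lemma bessel_y_scaled_recurrence:
  "bessel_y_scaled (int n + 1) c =
     of_nat (2 * n + 1) * ([:c:] * svar) * bessel_y_scaled (int n) c + bessel_y_scaled (int n - 1) c"
proof -
  have "pcompose (of_nat m) f = (of_nat m :: 'a poly)" for m f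
    by (simp add: of_nat_poly pcompose_const)
  moreover have "pcompose svar f = f" for f :: "'a poly"
    by (simp add: monom_altdef pcompose_pCons)
  ultimately show ?thesis
    unfolding bessel_y_scaled_def bessel_y_recurrence
    by (simp only: pcompose_add pcompose_mult) (simp add: smult_monom)
qed

text \<open>Substitution turns \<open>x\<^sup>2\<close> into \<open>c\<^sup>2 s\<^sup>2\<close>, and the chain rule absorbs one of the two factors \<open>c\<close>.
  Dividing by the other leaves the weight \<open>1/c\<close> that appears in \<open>C\<close> and in \<open>\<sigma>\<close>.\<close>

lemma bessel_y_scaled_derivative:
  assumes "c \<noteq> 0"
  shows "svar ^ 2 * pderiv (bessel_y_scaled (int n) c) =
     (of_nat n * svar - [:1 / c:]) * bessel_y_scaled (int n) c
       + [:1 / c:] * bessel_y_scaled (int n - 1) c"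
proof -
  let ?x = "monom c 1"
  let ?Y = "\<lambda>m. bessel_y_scaled m c"
  have n: "pcompose (of_nat m) f = (of_nat m :: 'a poly)" for m f
    by (simp add: of_nat_poly pcompose_const)
  have v: "pcompose svar f = f" for f :: "'a poly"
    by (simp add: monom_altdef pcompose_pCons)
  have x: "?x = [:c:] * svar"
    by (simp add: smult_monom)
  have inv: "[:1 / c:] * [:c:] = 1"
    using assms by (simp add: one_pCons)
  have "pcompose (svar ^ 2 * pderiv (bessel_y (int n))) ?x =
          pcompose ((of_nat n * svar - 1) * bessel_y (int n) + bessel_y (int n - 1)) ?x"
    by (simp only: bessel_y_derivative)
  then have eq: "?x ^ 2 * pcompose (pderiv (bessel_y (int n))) ?x =
          (of_nat n * ?x - 1) * ?Y (int n) + ?Y (int n - 1)"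
    unfolding bessel_y_scaled_def
    by (simp only: power2_eq_square pcompose_add pcompose_mult pcompose_diff n v pcompose_1)
  have "pderiv ?x = [:c:]"
    by (simp add: pderiv_monom monom_0)
  then have "pderiv (?Y (int n)) = [:c:] * pcompose (pderiv (bessel_y (int n))) ?x"
    by (simp only: bessel_y_scaled_def pderiv_pcompose mult.commute)
  then have "svar ^ 2 * pderiv (?Y (int n)) =
        [:1 / c:] * [:c:] * ([:c:] * svar ^ 2 * pcompose (pderiv (bessel_y (int n))) ?x)"
    unfolding inv by (simp only: mult_1 ac_simps)
  also have "\<dots> = [:1 / c:] * (?x ^ 2 * pcompose (pderiv (bessel_y (int n))) ?x)"
    unfolding x by (simp only: power2_eq_square ac_simps)
  also have "\<dots> = [:1 / c:] * [:c:] * (of_nat n * svar * ?Y (int n))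
        + [:1 / c:] * (?Y (int n - 1) - ?Y (int n))"
    unfolding eq unfolding x by (simp only: algebra_simps mult_1_left)
  finally show ?thesis
    unfolding inv by (simp only: algebra_simps mult_1_left)
qed

section \<open>The products\<close>

text \<open>Writing scalar multiples as products with constant polynomials makes the remaining claims pure
  identities in a commutative ring.\<close>

lemma smult_eq_const_mult: "smult a f = [:a:] * f"
  by simp

lemma g_poly_derivative:
  assumes "p \<noteq> 0" and "q \<noteq> 0"
  shows "svar ^ 2 * pderiv (g_poly p q l)
           + ([:sigma p q:] - of_nat (2 * l) * svar) * g_poly p q l = C_poly p q l"
proof -
  let ?P = "bessel_y_scaled (int l) p" and ?Q = "bessel_y_scaled (int l) q"
  have s: "[:sigma p q:] = [:1 / p:] + [:1 / q:]"
    by (simp add: sigma_def)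
  have "svar ^ 2 * pderiv (g_poly p q l) =
          ?P * (svar ^ 2 * pderiv ?Q) + ?Q * (svar ^ 2 * pderiv ?P)"
    unfolding g_poly_def pderiv_mult by (simp only: algebra_simps)
  then show ?thesis
    unfolding bessel_y_scaled_derivative[OF assms(1)] bessel_y_scaled_derivative[OF assms(2)]
      s C_poly_def g_poly_def smult_eq_const_mult of_nat_mult of_nat_numeral
    by algebra
qed

lemma C_poly_Suc:
  "C_poly p q (l + 1) = D_poly p q l + [:rho p q:] * of_nat (2 * l + 1) * svar * g_poly p q l"
proof -
  have i: "int (l + 1) = int l + 1" "int l + 1 - 1 = int l"
    by simp_all
  have r: "[:rho p q:] = [:1 / q:] * [:p:] + [:1 / p:] * [:q:]"
    by (simp add: rho_def)
  show ?thesis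
    unfolding C_poly_def D_poly_def g_poly_def i bessel_y_scaled_recurrence r smult_eq_const_mult
    by algebra
qed

lemma D_poly_Suc:
  assumes "p \<noteq> 0" and "q \<noteq> 0"
  shows "D_poly p q (l + 1) = C_poly p q l + 2 * of_nat (2 * l + 1) * svar * g_poly p q l"
proof -
  have i: "int (l + 1) = int l + 1" "int l + 1 - 1 = int l"
    by simp_all
  have "[:1 / p:] * [:p:] = 1" "[:1 / q:] * [:q:] = 1"
    using assms by (simp_all add: one_pCons)
  then show ?thesis
    unfolding C_poly_def D_poly_def g_poly_def i bessel_y_scaled_recurrence smult_eq_const_mult
    by algebra
qed

theorem theorem4p1:
  fixes p q :: "'a::field_char_0" and l :: nat
  assumes "p \<noteq> 0" and "q \<noteq> 0"
  shows "svar ^ 2 * pderiv (g_poly p q l)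
           + ([:sigma p q:] - of_nat (2 * l) * svar) * g_poly p q l
         = C_poly p q l
       \<and>
         (C_poly p q (l + 1)
           = D_poly p q l + [:rho p q:] * of_nat (2 * l + 1) * svar * g_poly p q l
          \<and>
          D_poly p q (l + 1)
           = C_poly p q l + 2 * of_nat (2 * l + 1) * svar * g_poly p q l)
       \<and>
         C_poly p q (l + 2)
         = C_poly p q l + 2 * of_nat (2 * l + 1) * svar * g_poly p q l
           + [:rho p q:] * of_nat (2 * l + 3) * svar * g_poly p q (l + 1)"
proof -
  have i: "l + 1 + 1 = l + 2" "2 * (l + 1) + 1 = 2 * l + 3"
    by simp_all
  have "C_poly p q (l + 2)
      = D_poly p q (l + 1) + [:rho p q:] * of_nat (2 * l + 3) * svar * g_poly p q (l + 1)"
    using C_poly_Suc[of p q "l + 1"] unfolding i .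
  then show ?thesis
    unfolding D_poly_Suc[OF assms]
    using g_poly_derivative[OF assms] C_poly_Suc D_poly_Suc[OF assms] by blast
qed

end
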